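(* Let $D>0$, $\gamma\in\mathbb{R}$, $v\in\mathbb{R}$, let $F:\mathbb{R}\to\mathbb{R}$, and let $\Gamma\in C^0([0,\infty))$ satisfy $\Gamma(\tau)\ge0$ for all $\tau\ge0$ and $\int_0^\infty\Gamma(\tau)\,d\tau=1$. Suppose that the equation $$\dot{\tilde u}(t,x)=D\,\tilde u_{xx}(t,x)+F(\tilde u(t,x))+\gamma\int_0^\infty\Gamma(\tau)\,\tilde u(t,x+v\tau)\,d\tau$$ has a bounded traveling-wave solution $\tilde u(t,x)=U(x-ct)$ whose wave speed $c$ equals the parameter $v$. Then $u(t,x)=U(x-vt)$ is also a solution of $$\dot u(t,x)=D\,u_{xx}(t,x)+F(u(t,x))+\gamma\int_0^\infty\Gamma(\tau)\,u(t-\tau,x)\,d\tau .$$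
   Context: A traveling-wave solution is a solution of the form $u(t,x)=U(x-ct)$ defined for all $(t,x)\in\mathbb{R}\times\mathbb{R}$, with profile $U:\mathbb{R}\to\mathbb{R}$ and speed $c\in\mathbb{R}$. The dot denotes the time derivative $\partial_t$. *)

theory Defs
  imports "HOL-Analysis.Analysis"
begin

text \<open>
  Solutions are classical and entire in time: functions \<open>u t x\<close> defined for all
  \<open>(t, x)\<close>, for which \<open>u\<^sub>t\<close>, \<open>u\<^sub>x\<close> and \<open>u\<^sub>x\<^sub>x\<close> exist everywhere and the equation holds pointwise.
  Since \<open>deriv\<close> and the Lebesgue integral are total in HOL, existence of the derivatives and of
  the integral is part of being a solution. Only values \<open>\<Gamma> \<tau>\<close> with \<open>\<tau> \<ge> 0\<close> matter.
\<close>

definition classical_regularity :: "(real \<Rightarrow> real \<Rightarrow> real) \<Rightarrow> bool" where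
  "classical_regularity u \<longleftrightarrow>
     (\<forall>t x. (\<lambda>s. u s x) differentiable (at t) \<and>
            u t differentiable (at x) \<and>
            deriv (u t) differentiable (at x))"

definition solves_nonlocal_equation ::
  "real \<Rightarrow> real \<Rightarrow> real \<Rightarrow> (real \<Rightarrow> real) \<Rightarrow> (real \<Rightarrow> real) \<Rightarrow> (real \<Rightarrow> real \<Rightarrow> real) \<Rightarrow> bool" where
  "solves_nonlocal_equation D \<gamma> v F \<Gamma> u \<longleftrightarrow>
     classical_regularity u \<and>
     (\<forall>t x. set_integrable lborel {0..} (\<lambda>\<tau>. \<Gamma> \<tau> * u t (x + v * \<tau>)) \<and>
        deriv (\<lambda>s. u s x) t =
          D * deriv (deriv (u t)) x + F (u t x)
          + \<gamma> * (LINT \<tau>:{0..}|lborel. \<Gamma> \<tau> * u t (x + v * \<tau>)))"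

definition solves_delay_equation ::
  "real \<Rightarrow> real \<Rightarrow> (real \<Rightarrow> real) \<Rightarrow> (real \<Rightarrow> real) \<Rightarrow> (real \<Rightarrow> real \<Rightarrow> real) \<Rightarrow> bool" where
  "solves_delay_equation D \<gamma> F \<Gamma> u \<longleftrightarrow>
     classical_regularity u \<and>
     (\<forall>t x. set_integrable lborel {0..} (\<lambda>\<tau>. \<Gamma> \<tau> * u (t - \<tau>) x) \<and>
        deriv (\<lambda>s. u s x) t =
          D * deriv (deriv (u t)) x + F (u t x)
          + \<gamma> * (LINT \<tau>:{0..}|lborel. \<Gamma> \<tau> * u (t - \<tau>) x))"

definition traveling_wave :: "(real \<Rightarrow> real) \<Rightarrow> real \<Rightarrow> (real \<Rightarrow> real \<Rightarrow> real) \<Rightarrow> bool" where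
  "traveling_wave U c u \<longleftrightarrow> (\<forall>t x. u t x = U (x - c * t))"

end

theory Submission imports Defs begin

text \<open>
  A wave of speed \<open>v\<close> is constant along the lines \<open>x - v t = const\<close>, so looking back in time by
  \<open>\<tau>\<close> gives the same value as looking ahead in space by \<open>v \<tau>\<close>. On such a wave the delayed and the
  nonlocal integrands therefore coincide for every \<open>\<tau>\<close>, and the two equations are the same.
\<close>

lemma traveling_wave_delay_eq_shift:
  assumes "traveling_wave U v u"
  shows "u (t - \<tau>) x = u t (x + v * \<tau>)"
  using assms by (simp add: traveling_wave_def algebra_simps)

lemma solves_delay_iff_solves_nonlocal:
  assumes "traveling_wave U v u"
  shows "solves_delay_equation D \<gamma> F \<Gamma> u \<longleftrightarrow> solves_nonlocal_equation D \<gamma> v F \<Gamma> u"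
  by (simp add: solves_delay_equation_def solves_nonlocal_equation_def
      traveling_wave_delay_eq_shift[OF assms])

theorem proposition2p1:
  fixes D \<gamma> v c :: real
    and F \<Gamma> U :: "real \<Rightarrow> real"
    and u' :: "real \<Rightarrow> real \<Rightarrow> real"
  assumes "D > 0"
    and "continuous_on {0..} \<Gamma>"
    and "\<And>\<tau>. \<tau> \<ge> 0 \<Longrightarrow> \<Gamma> \<tau> \<ge> 0"
    and "set_integrable lborel {0..} \<Gamma>"
    and "(LINT \<tau>:{0..}|lborel. \<Gamma> \<tau>) = 1"
    and "solves_nonlocal_equation D \<gamma> v F \<Gamma> u'"
    and "traveling_wave U c u'"
    and "bounded (range (\<lambda>(t, x). u' t x))"
    and "c = v"
  shows "solves_delay_equation D \<gamma> F \<Gamma> (\<lambda>t x. U (x - v * t))"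
proof -
  have "u' = (\<lambda>t x. U (x - v * t))"
    using assms(7,9) by (simp add: traveling_wave_def fun_eq_iff)
  then show ?thesis
    using assms(6,7,9) solves_delay_iff_solves_nonlocal by blast
qed

end
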